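(* Let $G=(V,E)$ be a finite directed graph with nonnegative edge distances $d_e$ and losses $l_e$, source $s$ and destination $t$, and for an $s$-$t$ path $P$ let $d(P)=\sum_{e\in P}d_e$, $l(P)=\sum_{e\in P}l_e$, assumed to satisfy $d(P)>0$. Let $\kappa=\frac{20}{\ln 10}$ and $f(P)=l(P)+\kappa\ln d(P)$, and let $(d^*,l^* )$ be the distance-loss pair of a dominant $s$-$t$ path (one minimizing $f$). Fix $r>1$, choose $u$ uniformly at random from $(0,1)$, set $\lambda_0=r^u$ and $\lambda_i=\lambda_0 r^i$ for $i\in\mathbb{Z}$. The geometric progression algorithm $\mathrm{GP}_{r,\lambda_0}$ computes, for each $i$, an $s$-$t$ path $P_i$ minimizing $l(P)+\lambda_i d(P)$, and outputs the path $P$ among the $P_i$ with smallest $f$. Then $$\mathbb{E}[f(P)]\le l^*+\kappa\ln d^*+\kappa\left(-\tfrac12\ln r+\ln(r-1)-\ln\ln r\right),$$ where the expectation is over the random choice of $u$ (the input is arbitrary).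
   Context: In the application (indoor dominant path model), $f$ is the modeled path loss in dB up to an additive constant, with $d$ Euclidean path length and $l$ total penetration plus diffraction loss; $\kappa\approx 8.686$ dB. *)

theory Defs
  imports "HOL-Probability.Probability" "Graph_Theory.Shortest_Path"
begin

definition kappa :: real where
  "kappa = 20 / ln 10"

context wf_digraph
begin

definition dominant_cost :: "'b weight_fun \<Rightarrow> 'b weight_fun \<Rightarrow> 'b awalk \<Rightarrow> real" where
  "dominant_cost d l p = awalk_cost l p + kappa * ln (awalk_cost d p)"

definition dominant_path :: "'b weight_fun \<Rightarrow> 'b weight_fun \<Rightarrow> 'a \<Rightarrow> 'a \<Rightarrow> 'b awalk \<Rightarrow> bool" where
  "dominant_path d l s t p \<longleftrightarrow> is_arg_min (dominant_cost d l) (\<lambda>q. apath s q t) p"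

definition linear_min_path ::
    "'b weight_fun \<Rightarrow> 'b weight_fun \<Rightarrow> 'a \<Rightarrow> 'a \<Rightarrow> real \<Rightarrow> 'b awalk \<Rightarrow> bool" where
  "linear_min_path d l s t lam p \<longleftrightarrow>
     is_arg_min (\<lambda>q. awalk_cost l q + lam * awalk_cost d q) (\<lambda>q. apath s q t) p"

text \<open>A relation rather than a function: ties, both in the choice of each \<open>P i\<close> and in the
  final choice among them, may be broken arbitrarily.\<close>

definition gp_output ::
    "'b weight_fun \<Rightarrow> 'b weight_fun \<Rightarrow> 'a \<Rightarrow> 'a \<Rightarrow> real \<Rightarrow> real \<Rightarrow> 'b awalk \<Rightarrow> bool" where
  "gp_output d l s t r lam0 p \<longleftrightarrow>
     (\<exists>P :: int \<Rightarrow> 'b awalk.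
        (\<forall>i. linear_min_path d l s t (lam0 * r powi i) (P i)) \<and>
        is_arg_min (dominant_cost d l) (\<lambda>q. q \<in> range P) p)"

end

end

theory Submission
  imports Defs
begin

text \<open>
  A minimizer of \<open>l + \<lambda> d\<close> with \<open>x = \<lambda> d\<^sup>* / \<kappa>\<close> exceeds the optimal value of \<open>f\<close> by at most
  \<open>\<kappa> (x - 1 - ln x)\<close>, because \<open>\<kappa> ln d - \<lambda> d\<close> is maximal at \<open>d = \<kappa> / \<lambda>\<close>. For every \<open>a > 0\<close> some
  \<open>\<lambda>\<^sub>i\<close> has \<open>x \<in> [a, a r)\<close>, and for that index \<open>log\<^sub>r (x / a)\<close> is uniform on \<open>[0, 1)\<close>. The expected
  excess is therefore at most \<open>\<kappa> (a (r - 1) / ln r - 1 - ln a - ln r / 2)\<close>, which is minimal at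
  \<open>a = ln r / (r - 1)\<close>. Measurability of the cost of the output holds for every way of breaking ties,
  as ties between different distance-loss pairs occur for countably many \<open>u\<close> only.
\<close>

section \<open>Real analysis: the trade-off inequality and averages over a uniform shift\<close>

lemma ln_tradeoff_bound:
  fixes k lam :: real
  assumes "0 < k" "0 < lam" "0 < d" "0 < d'"
    and "l + lam * d \<le> l' + lam * d'"
  shows "l + k * ln d \<le> l' + k * ln d' + k * (lam * d' / k - 1 - ln (lam * d' / k))"
proof -
  \<comment> \<open>Equality holds at \<open>d = k / lam\<close>. The tangent bound replaces
    \<open>k * ln d\<close> by a term linear in \<open>d\<close>, which the assumed inequality then
    trades for \<open>d'\<close>.\<close>
  have "ln (lam * d / k) \<le> lam * d / k - 1"
    using assms by (intro ln_le_minus_one) simp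
  then have "k * ln (lam * d / k) \<le> k * (lam * d / k - 1)"
    using assms(1) by (simp add: mult_left_mono)
  then show ?thesis
    using assms by (simp add: ln_mult ln_div algebra_simps)
qed

text \<open>Taking \<open>frac (u - c)\<close> only rotates the unit interval. It jumps at
  \<open>e = frac c\<close>: the left piece is translated onto the part above \<open>1 - e\<close>,
  the right piece onto the part below, and the fundamental theorem applies to each.\<close>

lemma has_integral_frac_shift:
  fixes h H :: "real \<Rightarrow> real"
  assumes H: "\<And>v. (H has_real_derivative h v) (at v)"
  shows "((\<lambda>u. h (frac (u - c))) has_integral (H 1 - H 0)) {0..1}"
proof -
  define e where "e = frac c"
  have e: "0 \<le> e" "e < 1"
    by (auto simp: e_def frac_lt_1)
  \<comment> \<open>At \<open>u = e\<close> the formula would give 1 instead of 0.\<close>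
  have wrap: "frac (u - c) = u + 1 - e" if "u \<in> {0..e} - {e}" for u
  proof -
    have "u - c - (u + 1 - e) = of_int (- \<lfloor>c\<rfloor> - 1)"
      by (simp add: e_def frac_def)
    then have "u - c - (u + 1 - e) \<in> \<int>"
      by (metis Ints_of_int)
    then show ?thesis
      using that e by (subst frac_unique_iff) auto
  qed
  \<comment> \<open>At \<open>u = 1\<close> the formula fails when \<open>e = 0\<close>.\<close>
  have nowrap: "frac (u - c) = u - e" if "u \<in> {e..1} - {1}" for u
  proof -
    have "u - c - (u - e) = of_int (- \<lfloor>c\<rfloor>)"
      by (simp add: e_def frac_def)
    then have "u - c - (u - e) \<in> \<int>"
      by (metis Ints_of_int)
    then show ?thesis
      using that e by (subst frac_unique_iff) auto
  qed
  have deriv: "((\<lambda>u. H (u + b)) has_vector_derivative h (u + b)) (at u within S)" for b u S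
    unfolding has_real_derivative_iff_has_vector_derivative[symmetric]
    by (rule has_field_derivative_at_within[OF DERIV_shift[THEN iffD1, OF H]])
  have "((\<lambda>u. h (u + (1 - e))) has_integral (H (e + (1 - e)) - H (0 + (1 - e)))) {0..e}"
    using e by (intro fundamental_theorem_of_calculus deriv) simp
  then have I1: "((\<lambda>u. h (u + (1 - e))) has_integral (H 1 - H (1 - e))) {0..e}"
    by simp
  have "((\<lambda>u. h (frac (u - c))) has_integral (H 1 - H (1 - e))) {0..e}"
    by (rule has_integral_spike_finite[OF _ _ I1, of "{e}"]) (auto simp: wrap add_diff_eq)
  moreover have "((\<lambda>u. h (u + - e)) has_integral (H (1 + - e) - H (e + - e))) {e..1}"
    using e by (intro fundamental_theorem_of_calculus deriv) simp
  then have I2: "((\<lambda>u. h (u + - e)) has_integral (H (1 - e) - H 0)) {e..1}"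
    by simp
  have "((\<lambda>u. h (frac (u - c))) has_integral (H (1 - e) - H 0)) {e..1}"
    by (rule has_integral_spike_finite[OF _ _ I2, of "{1}"]) (auto simp: nowrap)
  ultimately have "((\<lambda>u. h (frac (u - c))) has_integral (H 1 - H (1 - e) + (H (1 - e) - H 0))) {0..1}"
    using e by (intro has_integral_combine[where c = e]) auto
  then show ?thesis
    by simp
qed

lemma prob_space_uniform_unit: "prob_space (uniform_measure lborel {0<..<1::real})"
  by (rule prob_space_uniform_measure) auto

text \<open>Bridge from the expectation to the gauge integral, where antiderivatives are available:
  the unit interval has measure 1, so its uniform measure has the indicator as density.\<close>

lemma integral_uniform_unit:
  fixes f :: "real \<Rightarrow> real"
  assumes f: "integrable (uniform_measure lborel {0<..<1}) f"
    and meas: "f \<in> borel_measurable borel"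
    and I: "(f has_integral I) {0..1}"
  shows "integral\<^sup>L (uniform_measure lborel {0<..<1}) f = I"
proof -
  have eq: "uniform_measure lborel {0<..<1::real} = density lborel (\<lambda>x. ennreal (indicator {0<..<1} x))"
    unfolding uniform_measure_def by (intro arg_cong2[where f = density]) (auto simp: ennreal_indicator divide_ennreal_def)
  have int: "set_integrable lborel {0<..<1} f"
    using f meas unfolding eq set_integrable_def by (subst (asm) integrable_real_density) auto
  have "integral\<^sup>L (uniform_measure lborel {0<..<1}) f = (LINT x:{0<..<1}|lborel. f x)"
    using meas unfolding eq set_lebesgue_integral_def by (subst integral_real_density) auto
  also have "\<dots> = integral {0<..<1} f"
    by (rule set_borel_integral_eq_integral(2)[OF int])
  also have "\<dots> = I"
    using I by (simp add: has_integral_Icc_iff_Ioo integral_unique)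
  finally show ?thesis .
qed

lemma kappa_pos: "0 < kappa"
  by (simp add: kappa_def)

section \<open>Ties between paths and the parameters at which they occur\<close>

context fin_digraph
begin

text \<open>Ties at equal distance are left out: they force equal loss, hence equal dominant cost,
  and are harmless.\<close>

definition tie_params :: "'b weight_fun \<Rightarrow> 'b weight_fun \<Rightarrow> 'a \<Rightarrow> 'a \<Rightarrow> real set" where
  "tie_params d l s t = {lam. \<exists>p q. apath s p t \<and> apath s q t \<and> awalk_cost d p \<noteq> awalk_cost d q \<and>
     awalk_cost l p + lam * awalk_cost d p = awalk_cost l q + lam * awalk_cost d q}"

text \<open>Two lines of different slope meet once, and there are finitely many pairs of
  paths.\<close>

lemma finite_tie_params: "finite (tie_params d l s t)"
proof (rule finite_subset)
  let ?A = "{p. apath s p t}"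
  show "tie_params d l s t \<subseteq>
    (\<lambda>(p, q). (awalk_cost l q - awalk_cost l p) / (awalk_cost d p - awalk_cost d q)) ` (?A \<times> ?A)"
  proof
    fix lam assume "lam \<in> tie_params d l s t"
    then obtain p q where pq: "apath s p t" "apath s q t" "awalk_cost d p \<noteq> awalk_cost d q"
      "awalk_cost l p + lam * awalk_cost d p = awalk_cost l q + lam * awalk_cost d q"
      by (auto simp: tie_params_def)
    then have "lam = (awalk_cost l q - awalk_cost l p) / (awalk_cost d p - awalk_cost d q)"
      by (simp add: field_simps)
    with pq show "lam \<in> (\<lambda>(p, q). (awalk_cost l q - awalk_cost l p) /
        (awalk_cost d p - awalk_cost d q)) ` (?A \<times> ?A)"
      by (intro image_eqI[of _ _ "(p, q)"]) auto
  qed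
  show "finite ((\<lambda>(p, q). (awalk_cost l q - awalk_cost l p) /
      (awalk_cost d p - awalk_cost d q)) ` (?A \<times> ?A))"
    using apaths_finite by (intro finite_imageI finite_cartesian_product) auto
qed

lemma linear_min_path_iff:
  "linear_min_path d l s t lam p \<longleftrightarrow> apath s p t \<and>
     (\<forall>q. apath s q t \<longrightarrow>
       awalk_cost l p + lam * awalk_cost d p \<le> awalk_cost l q + lam * awalk_cost d q)"
  by (auto simp: linear_min_path_def is_arg_min_linorder)

lemma linear_min_path_cost_unique:
  assumes "linear_min_path d l s t lam p" "linear_min_path d l s t lam q"
    and "lam \<notin> tie_params d l s t"
  shows "dominant_cost d l p = dominant_cost d l q"
proof -
  have p: "apath s p t" and q: "apath s q t"
    using assms(1,2) by (auto simp: linear_min_path_iff)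
  have eq: "awalk_cost l p + lam * awalk_cost d p = awalk_cost l q + lam * awalk_cost d q"
    using assms(1,2) by (auto simp: linear_min_path_iff intro: antisym)
  with p q assms(3) have "awalk_cost d p = awalk_cost d q"
    by (auto simp: tie_params_def)
  with eq show ?thesis
    by (simp add: dominant_cost_def)
qed

lemma gp_output_le:
  assumes "gp_output d l s t r lam0 p"
  obtains q where "linear_min_path d l s t (lam0 * r powi i) q"
    "dominant_cost d l p \<le> dominant_cost d l q"
  using assms by (force simp: gp_output_def is_arg_min_linorder)

lemma gp_output_linear_min:
  assumes "gp_output d l s t r lam0 p"
  obtains i where "linear_min_path d l s t (lam0 * r powi i) p"
  using assms by (auto simp: gp_output_def is_arg_min_linorder)

text \<open>Away from ties all minimizers for one parameter cost the same, so the sublevel condition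
  can be stated without mentioning the chosen output \<open>p\<close>. This is what makes
  measurability independent of tie-breaking.\<close>

lemma gp_output_cost_le_iff:
  assumes "gp_output d l s t r lam0 p"
    and "\<And>i. lam0 * r powi i \<notin> tie_params d l s t"
  shows "dominant_cost d l p \<le> c \<longleftrightarrow>
    (\<exists>i q. linear_min_path d l s t (lam0 * r powi i) q \<and> dominant_cost d l q \<le> c)"
proof
  show "\<exists>i q. linear_min_path d l s t (lam0 * r powi i) q \<and> dominant_cost d l q \<le> c"
    if "dominant_cost d l p \<le> c"
    using that gp_output_linear_min[OF assms(1)] by metis
next
  assume "\<exists>i q. linear_min_path d l s t (lam0 * r powi i) q \<and> dominant_cost d l q \<le> c"
  then obtain i q where q: "linear_min_path d l s t (lam0 * r powi i) q" "dominant_cost d l q \<le> c"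
    by blast
  obtain q' where q': "linear_min_path d l s t (lam0 * r powi i) q'"
    "dominant_cost d l p \<le> dominant_cost d l q'"
    using gp_output_le[OF assms(1)] .
  show "dominant_cost d l p \<le> c"
    using linear_min_path_cost_unique[OF q(1) q'(1) assms(2)] q(2) q'(2) by simp
qed

text \<open>Each index and tie parameter determine \<open>u\<close> by a logarithm.\<close>

lemma countable_tie_exponents:
  assumes r: "1 < r"
  shows "countable {u. \<exists>i. r powr u * r powi i \<in> tie_params d l s t}"
proof (rule countable_subset)
  show "{u. \<exists>i. r powr u * r powi i \<in> tie_params d l s t}
    \<subseteq> (\<lambda>(i, x). log r (x / r powi i)) ` (UNIV \<times> tie_params d l s t)"
  proof clarify
    fix u i assume *: "r powr u * r powi i \<in> tie_params d l s t"
    show "u \<in> (\<lambda>(i, x). log r (x / r powi i)) ` (UNIV \<times> tie_params d l s t)"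
      using r * by (intro image_eqI[of _ _ "(i, r powr u * r powi i)"]) auto
  qed
  show "countable ((\<lambda>(i :: int, x). log r (x / r powi i)) ` (UNIV \<times> tie_params d l s t))"
    by (intro countable_image countable_SIGMA) (simp_all add: countable_finite finite_tie_params)
qed

section \<open>Measurability and integrability of the output cost\<close>

lemma sets_linear_min_path [measurable]:
  assumes "1 < r"
  shows "{u. linear_min_path d l s t (r powr u * r powi i) p} \<in> sets borel"
proof -
  have "{u. linear_min_path d l s t (r powr u * r powi i) p} =
    {u. apath s p t} \<inter> (\<Inter>q\<in>{q. apath s q t}. {u.
       awalk_cost l p + r powr u * r powi i * awalk_cost d p
       \<le> awalk_cost l q + r powr u * r powi i * awalk_cost d q})"
    by (auto simp: linear_min_path_iff)
  also have "closed \<dots>"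
    using assms by (intro closed_Int closed_INT ballI closed_Collect_le closed_Collect_const
        continuous_intros) auto
  finally show ?thesis
    by (rule borel_closed)
qed

lemma borel_measurable_gp_cost:
  assumes r: "1 < r"
    and GP: "\<And>lam0. 0 < lam0 \<Longrightarrow> gp_output d l s t r lam0 (GP lam0)"
  shows "(\<lambda>u. dominant_cost d l (GP (r powr u))) \<in> borel_measurable borel"
  unfolding borel_measurable_iff_le
proof
  fix c
  let ?phi = "\<lambda>u. dominant_cost d l (GP (r powr u))"
  define N where "N = {u. \<exists>i. r powr u * r powi i \<in> tie_params d l s t}"
  define B where "B = (\<Union>i. \<Union>p\<in>{p. apath s p t \<and> dominant_cost d l p \<le> c}.
    {u. linear_min_path d l s t (r powr u * r powi i) p})"
  have "countable N"
    unfolding N_def using r by (rule countable_tie_exponents)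
  then have N: "X \<subseteq> N \<Longrightarrow> X \<in> sets borel" for X
    by (meson countable_subset sets.countable borel_singleton sets.empty_sets)
  have "finite {p. apath s p t \<and> dominant_cost d l p \<le> c}"
    using apaths_finite[of s t] by (rule rev_finite_subset) auto
  then have B: "B \<in> sets borel"
    unfolding B_def using r
    by (intro sets.countable_UN' sets.finite_UN sets_linear_min_path) auto
  have "?phi u \<le> c \<longleftrightarrow> u \<in> B" if "u \<notin> N" for u
  proof -
    have "gp_output d l s t r (r powr u) (GP (r powr u))"
      using r by (intro GP) simp
    from gp_output_cost_le_iff[OF this] that show ?thesis
      by (auto simp: N_def B_def linear_min_path_iff)
  qed
  \<comment> \<open>On \<open>N\<close> the arbitrary choices of \<open>GP\<close> may produce any
    set, but every subset of the countable \<open>N\<close> is Borel.\<close>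
  then have "{u \<in> space borel. ?phi u \<le> c} = (B - N) \<union> ({u. ?phi u \<le> c} \<inter> N)"
    by auto
  also have "\<dots> \<in> sets borel"
    using B N by auto
  finally show "{u \<in> space borel. ?phi u \<le> c} \<in> sets borel" .
qed

lemma integrable_gp_cost:
  assumes r: "1 < r"
    and GP: "\<And>lam0. 0 < lam0 \<Longrightarrow> gp_output d l s t r lam0 (GP lam0)"
  shows "integrable (uniform_measure lborel {0<..<1}) (\<lambda>u. dominant_cost d l (GP (r powr u)))"
proof -
  interpret U: prob_space "uniform_measure lborel {0<..<1::real}"
    by (rule prob_space_uniform_unit)
  \<comment> \<open>The output is always one of finitely many paths, so one constant bounds its cost
    for every \<open>u\<close>.\<close>
  define K where "K = Max ((\<lambda>p. \<bar>dominant_cost d l p\<bar>) ` {p. apath s p t})"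
  have "\<bar>dominant_cost d l (GP (r powr u))\<bar> \<le> K" for u
  proof -
    have "gp_output d l s t r (r powr u) (GP (r powr u))"
      using r by (intro GP) simp
    then have "apath s (GP (r powr u)) t"
      by (metis gp_output_linear_min linear_min_path_iff)
    then show ?thesis
      unfolding K_def using apaths_finite[of s t] by (intro Max_ge) auto
  qed
  then show ?thesis
    using borel_measurable_gp_cost[OF r GP]
    by (intro U.integrable_const_bound[where B = K]) auto
qed

section \<open>The bound for fixed \<open>u\<close> and its expectation\<close>

lemma gp_cost_le:
  assumes r: "1 < r" and a: "0 < a"
    and pos: "\<And>p. apath s p t \<Longrightarrow> 0 < awalk_cost d p"
    and Q: "apath s Q t"
    and p: "gp_output d l s t r (r powr u) p"
  shows "dominant_cost d l p \<le> dominant_cost d l Q + kappa *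
    (a * r powr frac (u - log r (a * kappa / awalk_cost d Q)) - 1 - ln a
      - frac (u - log r (a * kappa / awalk_cost d Q)) * ln r)"
proof -
  define D where "D = awalk_cost d Q"
  have D: "0 < D"
    using pos[OF Q] by (simp add: D_def)
  \<comment> \<open>The exponent at which the normalized parameter
    \<open>r powr c * D / kappa\<close> equals \<open>a\<close>.\<close>
  define c where "c = log r (a * kappa / D)"
  \<comment> \<open>This index moves the exponent \<open>u\<close> by an integer into
    \<open>[c, c + 1)\<close>.\<close>
  define lam where "lam = r powr u * r powi (- \<lfloor>u - c\<rfloor>)"
  have lam: "0 < lam"
    using r by (simp add: lam_def)
  have rc: "r powr c = a * kappa / D"
    using r a D kappa_pos by (simp add: c_def)
  have "lam = r powr (u - \<lfloor>u - c\<rfloor>)"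
    using r by (simp add: lam_def powr_real_of_int' powr_diff power_int_minus divide_inverse)
  also have "u - \<lfloor>u - c\<rfloor> = c + frac (u - c)"
    by (simp add: frac_def)
  finally have x: "lam * D / kappa = a * r powr frac (u - c)"
    using D kappa_pos by (simp add: powr_add rc)
  obtain q where q: "linear_min_path d l s t lam q" "dominant_cost d l p \<le> dominant_cost d l q"
    using gp_output_le[OF p] unfolding lam_def .
  have "dominant_cost d l q \<le> dominant_cost d l Q +
      kappa * (lam * D / kappa - 1 - ln (lam * D / kappa))"
    unfolding dominant_cost_def D_def
    using q(1) Q pos lam kappa_pos by (intro ln_tradeoff_bound) (auto simp: linear_min_path_iff)
  also have "ln (lam * D / kappa) = ln a + frac (u - c) * ln r"
    using a r by (simp add: x ln_mult ln_powr)
  finally have "dominant_cost d l p \<le> dominant_cost d l Q +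
      kappa * (a * r powr frac (u - c) - 1 - ln a - frac (u - c) * ln r)"
    using q(2) by (simp only: x diff_diff_eq add.assoc)
  then show ?thesis
    by (simp only: c_def D_def)
qed

lemma expected_gp_cost_le:
  assumes r: "1 < r"
    and pos: "\<And>p. apath s p t \<Longrightarrow> 0 < awalk_cost d p"
    and Q: "apath s Q t"
    and GP: "\<And>lam0. 0 < lam0 \<Longrightarrow> gp_output d l s t r lam0 (GP lam0)"
  shows "integral\<^sup>L (uniform_measure lborel {0<..<1}) (\<lambda>u. dominant_cost d l (GP (r powr u)))
    \<le> dominant_cost d l Q + kappa * (- (1 / 2) * ln r + ln (r - 1) - ln (ln r))"
proof -
  interpret U: prob_space "uniform_measure lborel {0<..<1::real}"
    by (rule prob_space_uniform_unit)
  \<comment> \<open>The optimal window start: the mean of \<open>a * r powr v\<close> over the unit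
    interval becomes 1 and cancels the \<open>- 1\<close> in \<open>h\<close>.\<close>
  define a where "a = ln r / (r - 1)"
  have a: "0 < a"
    using r by (simp add: a_def)
  define c where "c = log r (a * kappa / awalk_cost d Q)"
  \<comment> \<open>The bound for fixed \<open>u\<close> as a function of the fractional part
    \<open>v\<close>; \<open>H\<close> is its antiderivative.\<close>
  define h where "h = (\<lambda>v. dominant_cost d l Q + kappa * (a * r powr v - 1 - ln a - v * ln r))"
  define H where "H = (\<lambda>v. dominant_cost d l Q * v +
    kappa * (a * r powr v / ln r - v - ln a * v - v\<^sup>2 / 2 * ln r))"
  have cont: "continuous_on UNIV h"
    unfolding h_def using r by (intro continuous_intros) auto
  have meas: "(\<lambda>u. h (frac (u - c))) \<in> borel_measurable borel"
    using borel_measurable_continuous_onI[OF cont] unfolding frac_def by measurable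
  \<comment> \<open>\<open>h\<close> is evaluated only at fractional parts, so a bound on the unit
    interval suffices for integrability.\<close>
  have "bounded (h ` {0..1})"
    using cont by (intro compact_imp_bounded compact_continuous_image)
      (auto intro: continuous_on_subset)
  then obtain K where "\<forall>y\<in>h ` {0..1}. norm y \<le> K"
    unfolding bounded_iff by blast
  then have K: "\<bar>h v\<bar> \<le> K" if "v \<in> {0..1}" for v
    using that by simp
  have int: "integrable (uniform_measure lborel {0<..<1}) (\<lambda>u. h (frac (u - c)))"
    using meas K by (intro U.integrable_const_bound[where B = K])
      (auto intro!: AE_I2 simp: less_imp_le frac_lt_1)
  have "(H has_real_derivative h v) (at v)" for v
    unfolding H_def h_def using r
    by (auto intro!: derivative_eq_intros simp: field_simps power2_eq_square)
  then have "((\<lambda>u. h (frac (u - c))) has_integral (H 1 - H 0)) {0..1}"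
    by (rule has_integral_frac_shift)
  then have I: "integral\<^sup>L (uniform_measure lborel {0<..<1}) (\<lambda>u. h (frac (u - c))) = H 1 - H 0"
    by (rule integral_uniform_unit[OF int meas])
  have "a * r / ln r - a / ln r = a * (r - 1) / ln r"
    by (simp add: diff_divide_distrib right_diff_distrib)
  also have "\<dots> = 1"
    using r by (simp add: a_def)
  finally have "a * r / ln r - a / ln r = 1" .
  moreover have "ln a = ln (ln r) - ln (r - 1)"
    using r by (simp add: a_def ln_div)
  moreover have "H 1 - H 0 = dominant_cost d l Q +
      kappa * ((a * r / ln r - a / ln r) - 1 - ln a - 1 / 2 * ln r)"
    using r by (simp add: H_def algebra_simps)
  ultimately have HH: "H 1 - H 0 = dominant_cost d l Q +
      kappa * (- (1 / 2) * ln r + ln (r - 1) - ln (ln r))"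
    by (simp only:) (simp add: algebra_simps)
  have "dominant_cost d l (GP (r powr u)) \<le> h (frac (u - c))" for u
    unfolding h_def c_def using r a pos Q GP by (intro gp_cost_le) auto
  then have "integral\<^sup>L (uniform_measure lborel {0<..<1}) (\<lambda>u. dominant_cost d l (GP (r powr u)))
      \<le> integral\<^sup>L (uniform_measure lborel {0<..<1}) (\<lambda>u. h (frac (u - c)))"
    by (intro integral_mono integrable_gp_cost[OF r GP] int)
  then show ?thesis
    by (simp only: I HH)
qed

end

theorem theorem5:
  fixes G :: "('a, 'b) pre_digraph"
    and d l :: "'b \<Rightarrow> real"
    and s t :: 'a
    and Pstar :: "'b list"
    and dstar lstar r :: real
    and GP :: "real \<Rightarrow> 'b list"
  assumes "fin_digraph G"
    and "\<And>e. e \<in> arcs G \<Longrightarrow> 0 \<le> d e"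
    and "\<And>e. e \<in> arcs G \<Longrightarrow> 0 \<le> l e"
    and "\<And>p. pre_digraph.apath G s p t \<Longrightarrow> 0 < wf_digraph.awalk_cost d p"
    and "wf_digraph.dominant_path G d l s t Pstar"
    and "dstar = wf_digraph.awalk_cost d Pstar"
    and "lstar = wf_digraph.awalk_cost l Pstar"
    and "1 < r"
    and "\<And>lam0. 0 < lam0 \<Longrightarrow> wf_digraph.gp_output G d l s t r lam0 (GP lam0)"
  shows "integrable (uniform_measure lborel {0<..<1})
           (\<lambda>u. wf_digraph.dominant_cost d l (GP (r powr u)))
       \<and> integral\<^sup>L (uniform_measure lborel {0<..<1})
           (\<lambda>u. wf_digraph.dominant_cost d l (GP (r powr u)))
         \<le> lstar + kappa * ln dstar
             + kappa * (- (1 / 2) * ln r + ln (r - 1) - ln (ln r))"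
proof -
  interpret fin_digraph G
    by fact
  have "apath s Pstar t"
    using assms(5) by (simp add: dominant_path_def is_arg_min_def)
  then show ?thesis
    using integrable_gp_cost[OF assms(8,9)] expected_gp_cost_le[OF assms(8,4) _ assms(9)]
    by (simp add: dominant_cost_def assms(6,7))
qed

end
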